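(* Let $X$ be an absolutely continuous nonnegative random variable with PDF $f$ and CDF $F$, where $F(t)>0$ for all $t>0$. Let $\{X_n,n\ge 1\}$ be the sequence of random variables built from $X_1\stackrel{D}{=}X$ with CDFs $F_1=F$, $F_{n+1}=F_n(1+T_n)$ and PDFs $f_1=f$, $f_{n+1}=T_nf_n$, where $T_n=-\log F_n$, and let $\tau_n=f_n/F_n$ be the reversed hazard rate of $X_n$. Then for any $t>0$ and for all $n=1,2,\ldots$, $$\mathbb E\left[\frac{T_n(X_n)}{\tau_n(X_n)}\,\Big|\,X_n\le t\right]=\mathcal{CE}(X_n;t)+\tilde\mu_n(t)\,T_n(t),$$ $${\rm cov}\left[X_n,T_n(X_n)\,|\,X_n\le t\right]=T_n(t)\left[\mu_n(t)-\mathbb E(X_n)\right]-\mathcal{CE}(X_n;t).$$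
   Context: The sequence is defined by $X_1\stackrel{D}{=}X$ and $[X_{n+1}\,|\,X_n=t]\stackrel{D}{=}[X_n\,|\,X_n\le t]$ for $t>0$, $n\ge1$; the CDFs and PDFs then satisfy the stated recursions on $(0,\infty)$. Notation, for $t>0$: $\tilde\mu_n(t)=\mathbb E[t-X_n\,|\,X_n\le t]=\frac{1}{F_n(t)}\int_0^tF_n(x)\,{\rm d}x$ (mean inactivity time); $\mu_n(t)=\mathbb E[X_n\,|\,X_n\le t]$ (mean past lifetime); $$\mathcal{CE}(X_n;t)=-\int_0^t\frac{F_n(x)}{F_n(t)}\log\frac{F_n(x)}{F_n(t)}\,{\rm d}x$$ (dynamic cumulative entropy). The symbol ${\rm cov}[X_n,T_n(X_n)\,|\,X_n\le t]$ denotes $$\mathbb E\big\{[X_n-\mathbb E(X_n)]\,[T_n(X_n)-\mathbb E(T_n(X_n))]\,\big|\,X_n\le t\big\},$$ with centring at the unconditional means.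
   Formalization: The first identity is proved assuming τ_n(x) ≠ 0 for almost every x in (0,t] with T_n(x) ≠ 0; without this it fails, e.g. f = 1/2 on (0,1) and (2,3), n = 1, t = 3. The covariance identity needs no such condition. *)

theory Defs
  imports "HOL-Probability.Probability"
begin

text \<open>Expectation and law given an event \<open>A\<close> of positive probability;
  \<open>uniform_measure M A\<close> is the conditional probability \<open>B \<mapsto> P(A \<inter> B) / P(A)\<close>.\<close>

definition cond_expect :: "'a measure \<Rightarrow> ('a \<Rightarrow> real) \<Rightarrow> 'a set \<Rightarrow> real" where
  "cond_expect M Z A = (\<integral>\<omega>. Z \<omega> \<partial>uniform_measure M A)"

definition at_most :: "'a measure \<Rightarrow> ('a \<Rightarrow> real) \<Rightarrow> real \<Rightarrow> 'a set" where
  "at_most M X t = {\<omega> \<in> space M. X \<omega> \<le> t}"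

definition law_at_most :: "'a measure \<Rightarrow> ('a \<Rightarrow> real) \<Rightarrow> real \<Rightarrow> real measure" where
  "law_at_most M X t = distr (uniform_measure M (at_most M X t)) borel X"

text \<open>\<open>K x\<close> is the conditional law of \<open>Y\<close> given \<open>X = x\<close>, for \<open>x > 0\<close>. The event \<open>X = x\<close> may be
  null, so this is the disintegration of the joint law of \<open>X\<close> and \<open>Y\<close> along the law of \<open>X\<close>.\<close>

definition has_cond_law_pos ::
  "'a measure \<Rightarrow> ('a \<Rightarrow> real) \<Rightarrow> ('a \<Rightarrow> real) \<Rightarrow> (real \<Rightarrow> real measure) \<Rightarrow> bool" where
  "has_cond_law_pos M Y X K \<longleftrightarrow>
    (\<forall>B \<in> sets borel. \<forall>C \<in> sets borel. B \<subseteq> {0<..} \<longrightarrow>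
      emeasure M {\<omega> \<in> space M. X \<omega> \<in> B \<and> Y \<omega> \<in> C}
        = (\<integral>\<^sup>+x\<in>B. emeasure (K x) C \<partial>distr M borel X))"

text \<open>Since \<open>ln 0 = 0\<close> and \<open>a / 0 = 0\<close>, both functions below vanish where \<open>F\<close> does; for a
  CDF that is positive on the positive reals this only concerns nonpositive arguments.\<close>

definition neg_log_cdf :: "(real \<Rightarrow> real) \<Rightarrow> real \<Rightarrow> real" where
  "neg_log_cdf F x = - ln (F x)"

definition reversed_hazard :: "(real \<Rightarrow> real) \<Rightarrow> (real \<Rightarrow> real) \<Rightarrow> real \<Rightarrow> real" where
  "reversed_hazard f F x = f x / F x"

definition mean_inactivity_time :: "'a measure \<Rightarrow> ('a \<Rightarrow> real) \<Rightarrow> real \<Rightarrow> real" where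
  "mean_inactivity_time M X t = cond_expect M (\<lambda>\<omega>. t - X \<omega>) (at_most M X t)"

definition mean_past_lifetime :: "'a measure \<Rightarrow> ('a \<Rightarrow> real) \<Rightarrow> real \<Rightarrow> real" where
  "mean_past_lifetime M X t = cond_expect M X (at_most M X t)"

definition dyn_cumulative_entropy :: "(real \<Rightarrow> real) \<Rightarrow> real \<Rightarrow> real" where
  "dyn_cumulative_entropy F t = - (LBINT x:{0..t}. F x / F t * ln (F x / F t))"

text \<open>The centring is at the unconditional means, so this is not the covariance under the
  conditional probability.\<close>

definition cond_cov :: "'a measure \<Rightarrow> ('a \<Rightarrow> real) \<Rightarrow> ('a \<Rightarrow> real) \<Rightarrow> 'a set \<Rightarrow> real" where
  "cond_cov M Y Z A =
    cond_expect M (\<lambda>\<omega>. (Y \<omega> - integral\<^sup>L M Y) * (Z \<omega> - integral\<^sup>L M Z)) A"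

end

theory Submission
  imports Defs
begin

text \<open>Writing \<open>\<mu>\<close> for the law of \<open>X\<^sub>n\<close>, the variable \<open>F\<^sub>n(X\<^sub>n)\<close> is uniform on \<open>[0, 1]\<close>, hence
  \<open>\<integral>\<^bsub>(s, \<infinity>)\<^esub> 1 / F\<^sub>n d\<mu> = T\<^sub>n(s)\<close>. Tonelli's theorem applied to the conditional law of \<open>X\<^bsub>n+1\<^esub>\<close>
  then shows that \<open>T\<^sub>n\<close> is the density of \<open>X\<^bsub>n+1\<^esub>\<close> relative to \<open>\<mu>\<close>, which gives both recursions.
  It also turns \<open>E[T\<^sub>n(X\<^sub>n) g(X\<^sub>n)]\<close> into \<open>E[g(X\<^bsub>n+1\<^esub>)]\<close>: thus \<open>E[T\<^sub>n(X\<^sub>n)] = 1\<close>, and the covariance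
  reduces to \<open>E[X\<^bsub>n+1\<^esub>; X\<^bsub>n+1\<^esub> \<le> t] = t F\<^bsub>n+1\<^esub>(t) - \<integral>\<^bsub>[0, t]\<^esub> F\<^bsub>n+1\<^esub>\<close>. The centring constant \<open>E[X\<^sub>n]\<close> could be
  any number, so the junk value \<open>0\<close> for a non-integrable \<open>X\<^sub>n\<close> does no harm.\<close>

section \<open>Probability integral transform\<close>

text \<open>Without atoms the CDF is continuous, so by the intermediate value theorem it attains
  every level in (0, 1). The set where it is at most \<open>u\<close> can then be compared with
  half-lines \<open>{..r}\<close> ending at points of known level.\<close>

lemma (in real_distribution) distr_cdf_uniform:
  assumes no_atoms: "\<And>x. measure M {x} = 0"
  shows "distr M borel (cdf M) = uniform_measure lborel {0..1::real}"
proof (rule cdf_unique)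
  have meas: "cdf M \<in> borel_measurable M"
    by (intro measurable_finite_borel borel_measurable_mono monoI cdf_nondecreasing)
  show "real_distribution (distr M borel (cdf M))"
    using meas by simp
  show "real_distribution (uniform_measure lborel {0..1::real})"
    unfolding real_distribution_def real_distribution_axioms_def
    by (auto intro!: prob_space_uniform_measure)
  have cont: "continuous_on S (cdf M)" for S
    using no_atoms by (simp add: continuous_at_imp_continuous_on isCont_cdf)
  have onto: "\<exists>s. cdf M s = v" if v: "0 < v" "v < 1" for v
  proof -
    obtain a where a: "cdf M a < v"
      using order_tendstoD(2)[OF cdf_lim_at_bot v(1)] by (auto simp: eventually_at_bot_linorder)
    obtain b where b: "v < cdf M b"
      using order_tendstoD(1)[OF cdf_lim_at_top_prob v(2)] by (auto simp: eventually_at_top_linorder)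
    have "a \<le> b"
      using a b cdf_nondecreasing[of b a] by linarith
    then show ?thesis
      using IVT'[of "cdf M" a v b] a b cont by auto
  qed
  have sets: "{x. cdf M x \<le> u} \<in> sets M" for u
    using measurable_sets[OF meas, of "{..u}"] by (simp add: vimage_def)
  show "cdf (distr M borel (cdf M)) = cdf (uniform_measure lborel {0..1::real})"
  proof
    fix u :: real
    let ?m = "measure M {x. cdf M x \<le> u}"
    \<comment> \<open>The level \<open>v\<close> lies strictly above \<open>u\<close> because the
      CDF may be flat at height \<open>u\<close>: a half-line ending at a point of level
      \<open>u\<close> could miss part of that plateau. The gap is closed by letting
      \<open>v\<close> decrease to \<open>u\<close>. The lower bound can use level \<open>u\<close>
      itself.\<close>
    have upper: "?m \<le> v" if v: "u < v" "0 < v" "v < 1" for v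
    proof -
      obtain r where r: "cdf M r = v"
        using onto v by blast
      have "{x. cdf M x \<le> u} \<subseteq> {..r}"
      proof (intro subsetI, rule ccontr)
        fix x assume "x \<in> {x. cdf M x \<le> u}" "x \<notin> {..r}"
        then show False using cdf_nondecreasing[of r x] v r by simp
      qed
      then show ?thesis
        using finite_measure_mono[of "{x. cdf M x \<le> u}" "{..r}"] r by (simp add: cdf_def)
    qed
    have upper': "?m \<le> max 0 u" if "u < 1"
    proof (rule dense_ge)
      fix z assume z: "max 0 u < z"
      show "?m \<le> z"
      proof (cases "z < 1")
        case True
        then show ?thesis using upper[of z] z by simp
      next
        case False
        then show ?thesis using prob_le_1[of "{x. cdf M x \<le> u}"] by linarith
      qed
    qed
    have lower: "u \<le> ?m" if u: "0 < u" "u < 1"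
    proof -
      obtain r where r: "cdf M r = u"
        using onto[OF u] by blast
      have "{..r} \<subseteq> {x. cdf M x \<le> u}"
        using cdf_nondecreasing r by auto
      then show ?thesis
        using finite_measure_mono[OF _ sets, of "{..r}" u] r by (simp add: cdf_def)
    qed
    have "?m = max 0 (min 1 u)"
    proof (cases "u < 1")
      case True
      then show ?thesis using upper' lower measure_nonneg[of M "{x. cdf M x \<le> u}"]
        by (cases "0 < u") (auto simp: max_def min_def intro: antisym)
    next
      case False
      then have "{x. cdf M x \<le> u} = space M"
        using cdf_bounded_prob order_trans by (auto simp: not_less)
      then show ?thesis
        using False prob_space by simp
    qed
    moreover have "{0..1} \<inter> {..u} = {0..min 1 u}"
      by auto
    ultimately show "cdf (distr M borel (cdf M)) u = cdf (uniform_measure lborel {0..1::real}) u"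
      using meas by (simp add: cdf_def measure_distr vimage_def max_def)
  qed
qed

section \<open>Integrals against an atomless law on the positive half-line\<close>

text \<open>These are the properties shared by all laws in the sequence: they hold for
  \<open>X\<close> and survive each step of the construction. Lebesgue densities are tracked
  separately, since only the identity with the reversed hazard rate involves them.\<close>

locale positive_distribution = real_distribution +
  assumes no_atoms: "measure M {x} = 0"
    and cdf_0: "cdf M 0 = 0"
    and cdf_pos: "0 < x \<Longrightarrow> 0 < cdf M x"
begin

lemma cdf_measurable [measurable]: "cdf M \<in> borel_measurable borel"
  by (intro borel_measurable_mono monoI cdf_nondecreasing)

lemma cdf_nonpos: "x \<le> 0 \<Longrightarrow> cdf M x = 0"
  using cdf_nondecreasing[of x 0] cdf_nonneg[of x] cdf_0 by simp

lemma neg_log_cdf_nonneg: "0 \<le> neg_log_cdf (cdf M) x"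
  using cdf_nonneg[of x] cdf_bounded_prob[of x]
  by (cases "cdf M x = 0") (simp_all add: neg_log_cdf_def)

lemma neg_log_cdf_measurable [measurable]: "neg_log_cdf (cdf M) \<in> borel_measurable borel"
  unfolding neg_log_cdf_def by measurable

lemma AE_positive: "AE x in M. 0 < x"
proof (rule AE_I')
  show "{..0} \<in> null_sets M"
    using cdf_0 by (auto simp: null_sets_def emeasure_eq_measure cdf_def)
qed auto

text \<open>Substituting \<open>u = cdf M x\<close>, which is uniform on [0, 1], leaves the integral
  of 1/u from \<open>cdf M a\<close> to 1.\<close>

lemma nn_integral_inverse_cdf:
  assumes "0 < a"
  shows "(\<integral>\<^sup>+x. ennreal (1 / cdf M x) * indicator {a<..} x \<partial>M) = ennreal (- ln (cdf M a))"
proof -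
  have Fa: "0 < cdf M a" "cdf M a \<le> 1"
    using assms cdf_pos cdf_bounded_prob by auto
  \<comment> \<open>A plateau of the CDF to the right of \<open>a\<close> would break the
    equivalence of \<open>a < x\<close> with a comparison of levels. Such points carry no mass,
    because the uniform law has no atom at \<open>cdf M a\<close>.\<close>
  have "AE u in uniform_measure lborel {0..1}. u \<noteq> cdf M a"
    by (rule AE_uniform_measureI) (use AE_lborel_singleton[of "cdf M a"] in auto)
  then have "AE u in distr M borel (cdf M). u \<noteq> cdf M a"
    by (simp only: distr_cdf_uniform[OF no_atoms])
  then have ne: "AE x in M. cdf M x \<noteq> cdf M a"
    by (subst (asm) AE_distr_iff) auto
  have "(\<integral>\<^sup>+x. ennreal (1 / cdf M x) * indicator {a<..} x \<partial>M)
      = (\<integral>\<^sup>+x. ennreal (1 / cdf M x) * indicator {cdf M a..} (cdf M x) \<partial>M)"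
  proof (rule nn_integral_cong_AE, use ne in eventually_elim)
    case (elim x)
    show ?case
    proof (cases "a < x")
      case True
      then show ?thesis using cdf_nondecreasing[of a x] by simp
    next
      case False
      then have "cdf M x < cdf M a"
        using cdf_nondecreasing[of x a] elim by simp
      then show ?thesis using False by simp
    qed
  qed
  also have "\<dots> = (\<integral>\<^sup>+u. ennreal (1 / u) * indicator {cdf M a..} u \<partial>distr M borel (cdf M))"
    by (simp add: nn_integral_distr)
  also have "\<dots> = (\<integral>\<^sup>+u. ennreal (1 / u) * indicator {cdf M a..} u * indicator {0..1} u \<partial>lborel)"
    by (simp add: distr_cdf_uniform[OF no_atoms] nn_integral_uniform_measure divide_ennreal_def)
  also have "\<dots> = (\<integral>\<^sup>+u. ennreal (1 / u) * indicator {cdf M a..1} u \<partial>lborel)"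
    using Fa by (intro nn_integral_cong) (auto split: split_indicator)
  also have "\<dots> = ennreal (ln 1 - ln (cdf M a))"
    using Fa by (intro nn_integral_FTC_Icc)
      (auto intro!: derivative_eq_intros simp: divide_inverse)
  finally show ?thesis by simp
qed

text \<open>For 0 < x \<le> t the number t - x is the length of \<open>{x..t}\<close>, that is, an
  integral over \<open>s\<close> of the indicator of x \<le> s. Exchanging the integrals turns this
  indicator into the CDF at \<open>s\<close>.\<close>

lemma nn_integral_deficit:
  assumes "0 \<le> t"
  shows "(\<integral>\<^sup>+x. ennreal (t - x) * indicator {..t} x \<partial>M)
    = (\<integral>\<^sup>+s. ennreal (cdf M s) * indicator {0..t} s \<partial>lborel)"
proof -
  interpret pair_sigma_finite M lborel ..
  have "(\<integral>\<^sup>+x. ennreal (t - x) * indicator {..t} x \<partial>M)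
      = (\<integral>\<^sup>+x. (\<integral>\<^sup>+s. indicator {..s} x * indicator {0..t} s \<partial>lborel) \<partial>M)"
  proof (rule nn_integral_cong_AE, use AE_positive in eventually_elim)
    case (elim x)
    have "(\<integral>\<^sup>+s. indicator {..s} x * indicator {0..t} s \<partial>lborel)
        = (\<integral>\<^sup>+s. indicator {x..t} s \<partial>lborel)"
      using elim by (intro nn_integral_cong) (auto split: split_indicator)
    also have "\<dots> = ennreal (t - x) * indicator {..t} x"
      by (auto split: split_indicator)
    finally show ?case by simp
  qed
  also have "\<dots> = (\<integral>\<^sup>+s. (\<integral>\<^sup>+x. indicator {..s} x * indicator {0..t} s \<partial>M) \<partial>lborel)"
    by (rule Fubini'[symmetric]) (unfold indicator_def atMost_iff atLeastAtMost_iff, measurable)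
  also have "\<dots> = (\<integral>\<^sup>+s. ennreal (cdf M s) * indicator {0..t} s \<partial>lborel)"
    by (intro nn_integral_cong) (simp add: nn_integral_multc cdf_def emeasure_eq_measure)
  finally show ?thesis .
qed

lemma integral_inactivity:
  assumes "0 \<le> t"
  shows "(\<integral>x. (t - x) * indicator {..t} x \<partial>M) = (LBINT s:{0..t}. cdf M s)"
proof -
  have "(\<integral>x. (t - x) * indicator {..t} x \<partial>M)
      = enn2real (\<integral>\<^sup>+x. ennreal ((t - x) * indicator {..t} x) \<partial>M)"
    by (intro integral_eq_nn_integral) (auto split: split_indicator)
  also have "(\<integral>\<^sup>+x. ennreal ((t - x) * indicator {..t} x) \<partial>M)
      = (\<integral>\<^sup>+x. ennreal (t - x) * indicator {..t} x \<partial>M)"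
    by (intro nn_integral_cong) (auto split: split_indicator)
  also have "\<dots> = (\<integral>\<^sup>+s. ennreal (cdf M s) * indicator {0..t} s \<partial>lborel)"
    by (rule nn_integral_deficit[OF assms])
  also have "\<dots> = (\<integral>\<^sup>+s. ennreal (indicator {0..t} s * cdf M s) \<partial>lborel)"
    by (intro nn_integral_cong) (auto split: split_indicator)
  also have "enn2real \<dots> = (\<integral>s. indicator {0..t} s * cdf M s \<partial>lborel)"
    by (intro integral_eq_nn_integral[symmetric]) (auto simp: cdf_nonneg)
  finally show ?thesis
    by (simp add: set_lebesgue_integral_def)
qed

lemma integrable_bounded_on_atMost:
  fixes g :: "real \<Rightarrow> real"
  assumes [measurable]: "g \<in> borel_measurable borel"
    and bound: "\<And>x. 0 < x \<Longrightarrow> x \<le> t \<Longrightarrow> \<bar>g x\<bar> \<le> B"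
  shows "integrable M (\<lambda>x. g x * indicator {..t} x)"
\<comment> \<open>The absolute value covers a negative \<open>B\<close>, which is possible when no x
  satisfies 0 < x \<le> t and the bound is vacuous.\<close>
proof (rule integrable_const_bound[where B = "\<bar>B\<bar>"])
  show "AE x in M. norm (g x * indicator {..t} x) \<le> \<bar>B\<bar>"
    using AE_positive
  proof eventually_elim
    case (elim x)
    then show ?case using bound[of x] by (auto split: split_indicator)
  qed
qed simp

text \<open>Writing x = t - (t - x) reduces this to \<open>integral_inactivity\<close>. The
  truncation at \<open>t\<close> keeps every term integrable even if the law has infinite
  mean.\<close>

lemma integral_atMost_id:
  assumes "0 \<le> t"
  shows "(\<integral>x. x * indicator {..t} x \<partial>M) = t * cdf M t - (LBINT s:{0..t}. cdf M s)"
proof -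
  have "integrable M (\<lambda>x. x * indicator {..t} x)"
    by (rule integrable_bounded_on_atMost[where B = t]) auto
  moreover have "integrable M (\<lambda>x. t * indicator {..t} x)"
    by (rule integrable_bounded_on_atMost[where B = t]) (use assms in auto)
  ultimately have "(\<integral>x. (t - x) * indicator {..t} x \<partial>M)
      = (\<integral>x. t * indicator {..t} x \<partial>M) - (\<integral>x. x * indicator {..t} x \<partial>M)"
    by (simp add: left_diff_distrib)
  then show ?thesis
    using integral_inactivity[OF assms] by (simp add: cdf_def)
qed

end

section \<open>One step of the construction: from the law of \<open>X\<close> to the law of
  \<open>Y\<close>\<close>

context
  fixes N :: "'b measure" and X Y :: "'b \<Rightarrow> real"
  assumes N: "prob_space N"
    and X [measurable]: "X \<in> borel_measurable N"
    and Y [measurable]: "Y \<in> borel_measurable N"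
    and pos: "positive_distribution (distr N borel X)"
    and law: "has_cond_law_pos N Y X (law_at_most N X)"
begin

interpretation N: prob_space N by (rule N)
interpretation D: positive_distribution "distr N borel X" by (rule pos)

lemma emeasure_law_at_most:
  assumes [measurable]: "C \<in> sets borel" and x: "0 < x"
  shows "emeasure (law_at_most N X x) C
    = emeasure (distr N borel X) (C \<inter> {..x}) * ennreal (1 / cdf (distr N borel X) x)"
proof -
  have at_most: "at_most N X x = X -` {..x} \<inter> space N"
    by (auto simp: at_most_def)
  have [measurable]: "at_most N X x \<in> sets N"
    unfolding at_most by measurable
  have "emeasure N (at_most N X x) = ennreal (cdf (distr N borel X) x)"
    by (simp add: cdf_def measure_distr at_most N.emeasure_eq_measure)
  moreover have "emeasure N (at_most N X x \<inter> (X -` C \<inter> space N))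
      = emeasure (distr N borel X) (C \<inter> {..x})"
    by (subst emeasure_distr) (auto simp: at_most intro!: arg_cong2[where f = emeasure])
  ultimately show ?thesis
    using D.cdf_pos[OF x]
    by (simp add: law_at_most_def emeasure_distr divide_ennreal_def inverse_ennreal inverse_eq_divide)
qed

text \<open>The conditional law is prescribed only on the positive reals, but \<open>X\<close> is
  almost surely positive, so conditioning on all positive values recovers the whole marginal law of
  \<open>Y\<close>.\<close>

lemma emeasure_next_law:
  assumes [measurable]: "C \<in> sets borel"
  shows "emeasure (distr N borel Y) C
    = (\<integral>\<^sup>+x. emeasure (distr N borel X) (C \<inter> {..x})
        * (ennreal (1 / cdf (distr N borel X) x) * indicator {0<..} x) \<partial>distr N borel X)"
proof -
  have "AE \<omega> in N. 0 < X \<omega>"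
    using D.AE_positive by (subst (asm) AE_distr_iff) auto
  then have "emeasure (distr N borel Y) C = emeasure N {\<omega> \<in> space N. X \<omega> \<in> {0<..} \<and> Y \<omega> \<in> C}"
    by (subst emeasure_distr) (auto intro!: emeasure_eq_AE)
  also have "\<dots> = (\<integral>\<^sup>+x\<in>{0<..}. emeasure (law_at_most N X x) C \<partial>distr N borel X)"
    by (rule law[unfolded has_cond_law_pos_def, rule_format]) auto
  also have "\<dots> = (\<integral>\<^sup>+x. emeasure (distr N borel X) (C \<inter> {..x})
        * (ennreal (1 / cdf (distr N borel X) x) * indicator {0<..} x) \<partial>distr N borel X)"
    by (intro nn_integral_cong) (auto simp: emeasure_law_at_most split: split_indicator)
  finally show ?thesis .
qed

lemma next_law_density:
  "distr N borel Y
    = density (distr N borel X) (\<lambda>x. ennreal (neg_log_cdf (cdf (distr N borel X)) x))"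
  (is "_ = density ?D ?T")
proof (rule measure_eqI)
  fix C assume "C \<in> sets (distr N borel Y)"
  then have [measurable]: "C \<in> sets borel" by simp
  interpret DD: pair_sigma_finite ?D ?D ..
  let ?h = "\<lambda>x. ennreal (1 / cdf ?D x) * indicator {0<..} x"
  have "emeasure (distr N borel Y) C
      = (\<integral>\<^sup>+x. (\<integral>\<^sup>+s. indicator C s * indicator {..x} s * ?h x \<partial>?D) \<partial>?D)"
    unfolding emeasure_next_law[OF \<open>C \<in> sets borel\<close>]
    by (intro nn_integral_cong) (simp add: nn_integral_multc flip: indicator_inter_arith)
  also have "\<dots> = (\<integral>\<^sup>+s. (\<integral>\<^sup>+x. indicator C s * indicator {..x} s * ?h x \<partial>?D) \<partial>?D)"
    by (rule DD.Fubini') (unfold indicator_def atMost_iff greaterThan_iff, measurable)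
  also have "\<dots> = (\<integral>\<^sup>+s. ?T s * indicator C s \<partial>?D)"
  proof (rule nn_integral_cong_AE, use D.AE_positive in eventually_elim)
    case (elim s)
    \<comment> \<open>Tonelli leaves the closed range s \<le> x, whereas
      \<open>nn_integral_inverse_cdf\<close> treats the open one; the point \<open>s\<close> has
      mass 0.\<close>
    have "AE x in ?D. x \<noteq> s"
      by (rule AE_I'[of "{s}"]) (auto simp: null_sets_def D.emeasure_eq_measure D.no_atoms)
    then have "(\<integral>\<^sup>+x. indicator C s * indicator {..x} s * ?h x \<partial>?D)
        = (\<integral>\<^sup>+x. indicator C s * (ennreal (1 / cdf ?D x) * indicator {s<..} x) \<partial>?D)"
      by (intro nn_integral_cong_AE, eventually_elim) (use elim in \<open>auto split: split_indicator\<close>)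
    then show ?case
      using D.nn_integral_inverse_cdf[OF elim]
      by (simp add: nn_integral_cmult neg_log_cdf_def mult.commute)
  qed
  also have "\<dots> = emeasure (density ?D ?T) C"
    by (simp add: emeasure_density neg_log_cdf_def)
  finally show "emeasure (distr N borel Y) C = emeasure (density ?D ?T) C" .
qed simp

text \<open>In \<open>emeasure_next_law\<close> with \<open>C = {..y}\<close>, values x \<le> y
  contribute F(x)/F(x) = 1, hence F(y) in total. Values x > y contribute F(y)/F(x), which integrates
  to F(y) T(y).\<close>

lemma next_law_cdf:
  "cdf (distr N borel Y) y
    = cdf (distr N borel X) y * (1 + neg_log_cdf (cdf (distr N borel X)) y)"
  (is "cdf ?E y = cdf ?D y * _")
proof -
  interpret E: real_distribution ?E by (rule N.real_distribution_distr) simp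
  let ?h = "\<lambda>x. ennreal (1 / cdf ?D x)"
  show ?thesis
  proof (cases "0 < y")
    case False
    \<comment> \<open>For y \<le> 0 both CDFs vanish, so the product formula holds whatever value
      the logarithm takes there. The recursion for \<open>Fs\<close> is required at all real
      arguments.\<close>
    have "emeasure ?D ({..y} \<inter> {..x}) = 0" for x
      using D.cdf_nonpos[of "min y x"] False
      by (simp add: D.emeasure_eq_measure cdf_def Int_atMost)
    then have "emeasure ?E {..y} = 0"
      unfolding emeasure_next_law[OF atMost_borel] by simp
    then have "cdf ?E y = 0"
      by (simp add: cdf_def measure_def)
    then show ?thesis using False D.cdf_nonpos by simp
  next
    case True
    have F: "0 < cdf ?D y" "cdf ?D y \<le> 1"
      using D.cdf_pos True D.cdf_bounded_prob by auto
    then have ln: "0 \<le> - ln (cdf ?D y)" "0 \<le> cdf ?D y * - ln (cdf ?D y)"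
      "0 \<le> cdf ?D y * (1 - ln (cdf ?D y))"
      using ln_le_zero_iff[of "cdf ?D y"] order_trans[of "ln (cdf ?D y)" 0 1]
      by (auto simp: mult_le_0_iff intro!: mult_nonneg_nonneg)
    have "emeasure ?E {..y} = (\<integral>\<^sup>+x. indicator {..y} x
        + ennreal (cdf ?D y) * (?h x * indicator {y<..} x) \<partial>?D)"
      unfolding emeasure_next_law[OF atMost_borel]
    proof (rule nn_integral_cong_AE, use D.AE_positive in eventually_elim)
      case (elim x)
      show ?case
      proof (cases "x \<le> y")
        case True
        then have "{..y} \<inter> {..x} = {..x}" by auto
        then show ?thesis
          using True elim D.cdf_pos[OF elim]
          by (simp add: D.emeasure_eq_measure cdf_def flip: ennreal_mult)
      next
        case False
        then have "{..y} \<inter> {..x} = {..y}" by auto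
        then show ?thesis
          using False elim by (simp add: D.emeasure_eq_measure cdf_def)
      qed
    qed
    also have "\<dots> = emeasure ?D {..y} + ennreal (cdf ?D y) * ennreal (- ln (cdf ?D y))"
      using True by (simp add: nn_integral_add nn_integral_cmult D.nn_integral_inverse_cdf)
    also have "emeasure ?D {..y} = ennreal (cdf ?D y)"
      by (simp add: D.emeasure_eq_measure cdf_def)
    also have "ennreal (cdf ?D y) + ennreal (cdf ?D y) * ennreal (- ln (cdf ?D y))
        = ennreal (cdf ?D y * (1 - ln (cdf ?D y)))"
      using F ln by (simp add: right_diff_distrib flip: ennreal_mult ennreal_plus)
    finally show ?thesis
      using ln(3) by (simp add: cdf_def[of ?E] E.emeasure_eq_measure neg_log_cdf_def)
  qed
qed


text \<open>Null sets of the old law remain null under a density, so no atom can appear; the two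
  conditions on the CDF follow from \<open>next_law_cdf\<close>.\<close>

lemma next_law_positive: "positive_distribution (distr N borel Y)"
  (is "positive_distribution ?E")
proof -
  let ?D = "distr N borel X"
  interpret E: real_distribution ?E by (rule N.real_distribution_distr) simp
  show ?thesis
  proof
    fix x
    have "{x} \<in> null_sets ?D"
      by (auto simp: null_sets_def D.emeasure_eq_measure D.no_atoms)
    then have "{x} \<in> null_sets (density ?D (\<lambda>x. ennreal (neg_log_cdf (cdf ?D) x)))"
      using absolutely_continuousI_density[of "\<lambda>x. ennreal (neg_log_cdf (cdf ?D) x)" ?D]
      by (auto simp: absolutely_continuous_def)
    then show "measure ?E {x} = 0"
      by (simp add: next_law_density null_sets_def measure_def)
  next
    show "cdf ?E 0 = 0"
      by (simp add: next_law_cdf D.cdf_0)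
  next
    fix x :: real assume "0 < x"
    then show "0 < cdf ?E x"
      using D.cdf_pos D.neg_log_cdf_nonneg[of x] by (auto simp: next_law_cdf intro!: mult_pos_pos)
  qed
qed

text \<open>This change of measure absorbs the logarithmic weight into the law of \<open>Y\<close>,
  where the integrals needed for the covariance are read off from the CDF.\<close>

lemma integral_next_law:
  fixes g :: "real \<Rightarrow> real"
  assumes [measurable]: "g \<in> borel_measurable borel"
  shows "(\<integral>x. g x \<partial>distr N borel Y)
    = (\<integral>x. neg_log_cdf (cdf (distr N borel X)) x * g x \<partial>distr N borel X)"
  unfolding next_law_density by (simp add: integral_density D.neg_log_cdf_nonneg)

lemma integrable_next_law:
  fixes g :: "real \<Rightarrow> real"
  assumes [measurable]: "g \<in> borel_measurable borel"
  shows "integrable (distr N borel Y) g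
    \<longleftrightarrow> integrable (distr N borel X) (\<lambda>x. neg_log_cdf (cdf (distr N borel X)) x * g x)"
  unfolding next_law_density by (simp add: integrable_density D.neg_log_cdf_nonneg)

end

text \<open>Conditioning is a density that is constant on the event, and the rest is transport to
  the law of \<open>X\<close>. If \<open>g\<close> is not integrable on the event, both sides are
  0.\<close>

lemma cond_expect_at_most:
  fixes g :: "real \<Rightarrow> real"
  assumes N: "prob_space N"
    and [measurable]: "X \<in> borel_measurable N" "g \<in> borel_measurable borel"
    and pos: "0 < cdf (distr N borel X) t"
  shows "cond_expect N (\<lambda>\<omega>. g (X \<omega>)) (at_most N X t)
    = (\<integral>x. g x * indicator {..t} x \<partial>distr N borel X) / cdf (distr N borel X) t"
proof -
  interpret prob_space N by (rule N)
  let ?F = "cdf (distr N borel X) t"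
  have at_most: "at_most N X t = X -` {..t} \<inter> space N"
    by (auto simp: at_most_def)
  have [measurable]: "at_most N X t \<in> sets N"
    unfolding at_most by measurable
  have F: "emeasure N (at_most N X t) = ennreal ?F"
    by (simp add: cdf_def measure_distr at_most emeasure_eq_measure)
  have "uniform_measure N (at_most N X t)
      = density N (\<lambda>\<omega>. ennreal (indicator (at_most N X t) \<omega> / ?F))"
    unfolding uniform_measure_def F using pos
    by (intro density_cong) (auto split: split_indicator simp: divide_ennreal[symmetric])
  then have "cond_expect N (\<lambda>\<omega>. g (X \<omega>)) (at_most N X t)
      = (\<integral>\<omega>. (indicator (at_most N X t) \<omega> / ?F) *\<^sub>R g (X \<omega>) \<partial>N)"
    unfolding cond_expect_def using pos by (simp only:) (intro integral_density, auto)
  also have "\<dots> = (\<integral>\<omega>. g (X \<omega>) * indicator {..t} (X \<omega>) / ?F \<partial>N)"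
    by (intro Bochner_Integration.integral_cong) (auto simp: at_most split: split_indicator)
  also have "\<dots> = (\<integral>x. g x * indicator {..t} x \<partial>distr N borel X) / ?F"
    by (simp add: integral_distr)
  finally show ?thesis .
qed

section \<open>Cumulative entropy and the integral with the reversed hazard rate\<close>

context positive_distribution
begin

lemma set_integrable_cdf: "set_integrable lborel {0..t} (cdf M)"
  unfolding set_integrable_def
  by (rule integrableI_bounded_set_indicator[where B = 1])
    (auto simp: cdf_nonneg cdf_bounded_prob emeasure_lborel_Icc_eq)

lemma set_integrable_cdf_neg_log:
  "set_integrable lborel {0..t} (\<lambda>x. cdf M x * neg_log_cdf (cdf M) x)"
  unfolding set_integrable_def
proof (rule integrableI_bounded_set_indicator[where B = 1])
  \<comment> \<open>From ln v \<le> v - 1 at v = 1/u, the value - u ln u is at most 1 - u.\<close>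
  have "cdf M x * neg_log_cdf (cdf M) x \<le> 1" for x
  proof (cases "cdf M x = 0")
    case False
    then have u: "0 < cdf M x" using cdf_nonneg[of x] by simp
    then have "- ln (cdf M x) \<le> 1 / cdf M x - 1"
      using ln_le_minus_one[of "1 / cdf M x"] by (simp add: ln_div)
    then have "cdf M x * - ln (cdf M x) \<le> cdf M x * (1 / cdf M x - 1)"
      using u by (intro mult_left_mono) auto
    also have "\<dots> \<le> 1" using u by (simp add: algebra_simps)
    finally show ?thesis by (simp add: neg_log_cdf_def)
  qed simp
  then show "AE x\<in>{0..t} in lborel. norm (cdf M x * neg_log_cdf (cdf M) x) \<le> 1"
    by (simp add: cdf_nonneg neg_log_cdf_nonneg)
qed (auto simp: emeasure_lborel_Icc_eq)

text \<open>Splitting the logarithm of the quotient expresses the entropy through the integrals of F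
  and of F T over \<open>{0..t}\<close>, to which both identities are reduced. Where F vanishes, the
  factor F makes both integrands 0.\<close>

lemma dyn_cumulative_entropy_eq:
  assumes "0 < t"
  shows "dyn_cumulative_entropy (cdf M) t
    = ((LBINT x:{0..t}. cdf M x * neg_log_cdf (cdf M) x)
        - neg_log_cdf (cdf M) t * (LBINT x:{0..t}. cdf M x)) / cdf M t"
proof -
  let ?F = "cdf M" and ?T = "neg_log_cdf (cdf M)"
  have Ft: "0 < ?F t" using assms cdf_pos by simp
  have "- (?F x / ?F t * ln (?F x / ?F t)) = (?F x * ?T x - ?T t * ?F x) / ?F t"
    for x
  proof (cases "?F x = 0")
    case False
    then have "0 < ?F x" using cdf_nonneg[of x] by simp
    then show ?thesis using Ft by (simp add: neg_log_cdf_def ln_div field_simps)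
  qed simp
  then have "dyn_cumulative_entropy ?F t
      = (LBINT x:{0..t}. (?F x * ?T x - ?T t * ?F x) / ?F t)"
    unfolding dyn_cumulative_entropy_def set_lebesgue_integral_def
    by (simp only: Bochner_Integration.integral_minus[symmetric] scaleR_minus_right[symmetric])
  also have "\<dots> = ((LBINT x:{0..t}. ?F x * ?T x) - (LBINT x:{0..t}. ?T t * ?F x)) / ?F t"
    using set_integral_diff(2)[OF set_integrable_cdf_neg_log
        set_integrable_mult_right[OF set_integrable_cdf]]
    by (simp add: set_integral_divide_zero)
  finally show ?thesis by simp
qed

text \<open>The density cancels: f T / (f / F) = F T wherever f and F are nonzero. On a gap in the
  support f is 0 and so is the left integrand, while F T may be positive; \<open>ne\<close> rules
  this out up to Lebesgue null sets.\<close>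

lemma integral_neg_log_div_hazard:
  assumes dens: "M = density lborel (\<lambda>x. ennreal (f x))"
    and [measurable]: "f \<in> borel_measurable borel" and nonneg: "\<And>x. 0 \<le> f x"
    and ne: "AE x in lborel. 0 < x \<and> x \<le> t \<and> neg_log_cdf (cdf M) x \<noteq> 0
      \<longrightarrow> reversed_hazard f (cdf M) x \<noteq> 0"
  shows "(\<integral>x. neg_log_cdf (cdf M) x / reversed_hazard f (cdf M) x * indicator {..t} x \<partial>M)
    = (LBINT x:{0..t}. cdf M x * neg_log_cdf (cdf M) x)"
proof -
  let ?T = "neg_log_cdf (cdf M)" and ?\<tau> = "reversed_hazard f (cdf M)"
  have [measurable]: "?\<tau> \<in> borel_measurable borel"
    unfolding reversed_hazard_def by measurable
  have "(\<integral>x. ?T x / ?\<tau> x * indicator {..t} x \<partial>M)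
      = (\<integral>x. ?T x / ?\<tau> x * indicator {..t} x \<partial>density lborel (\<lambda>x. ennreal (f x)))"
    using dens by simp
  also have "\<dots> = (\<integral>x. f x * (?T x / ?\<tau> x * indicator {..t} x) \<partial>lborel)"
    using nonneg by (subst integral_density) auto
  also have "\<dots> = (\<integral>x. indicator {0..t} x * (cdf M x * ?T x) \<partial>lborel)"
  proof (rule integral_cong_AE)
    show "AE x in lborel. f x * (?T x / ?\<tau> x * indicator {..t} x)
        = indicator {0..t} x * (cdf M x * ?T x)"
      using ne
    proof eventually_elim
      case (elim x)
      show ?case
      proof (cases "0 < x \<and> x \<le> t \<and> ?T x \<noteq> 0")
        case True
        then show ?thesis using elim by (simp add: reversed_hazard_def)
      next
        \<comment> \<open>Either x > t and both indicators vanish, or T is 0 and both sides are 0.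
          The case x \<le> 0 belongs to the latter, since F(x) = 0 and
          \<open>ln 0 = 0\<close>.\<close>
        case False
        then show ?thesis using cdf_nonpos[of x]
          by (auto simp: neg_log_cdf_def not_less split: split_indicator)
      qed
    qed
  qed measurable
  finally show ?thesis by (simp add: set_lebesgue_integral_def)
qed

end


section \<open>The two identities for one member of the sequence\<close>

text \<open>The variable \<open>Y\<close> enters only through its law, which carries the weight T.
  With T centred at 1, the factor T - 1 integrates over \<open>{..t}\<close> to F(t) T(t), and x (T
  - 1) integrates to t F(t) T(t) minus the integral of F T.\<close>

lemma cond_cov_next_law:
  assumes N: "prob_space N"
    and X [measurable]: "X \<in> borel_measurable N" and Y [measurable]: "Y \<in> borel_measurable N"
    and pos: "positive_distribution (distr N borel X)"
    and law: "has_cond_law_pos N Y X (law_at_most N X)"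
    and F: "F = cdf (distr N borel X)"
    and t: "0 < t"
  shows "cond_cov N X (\<lambda>\<omega>. neg_log_cdf F (X \<omega>)) (at_most N X t)
    = neg_log_cdf F t * (mean_past_lifetime N X t - integral\<^sup>L N X) - dyn_cumulative_entropy F t"
proof -
  interpret prob_space N by (rule N)
  let ?D = "distr N borel X" and ?E = "distr N borel Y" and ?T = "neg_log_cdf F"
  interpret D: positive_distribution ?D by (rule pos)
  interpret E: positive_distribution ?E by (rule next_law_positive[OF N X Y pos law])
  note integral_E = integral_next_law[OF N X Y pos law, folded F]
    and integrable_E = integrable_next_law[OF N X Y pos law, folded F]
    and cdf_E = next_law_cdf[OF N X Y pos law, folded F]
  have [measurable]: "?T \<in> borel_measurable borel" "F \<in> borel_measurable borel"
    by (simp_all add: F)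
  have Ft: "0 < F t" using D.cdf_pos[OF t] by (simp add: F)
  define m where "m = integral\<^sup>L N X"
  define I where "I = (LBINT x:{0..t}. F x)"
  define J where "J = (LBINT x:{0..t}. F x * ?T x)"
  have mean_T: "(\<integral>\<omega>. ?T (X \<omega>) \<partial>N) = 1"
    using integral_E[of "\<lambda>_. 1"] E.prob_space by (simp add: integral_distr)
  have T1: "(\<integral>x. ?T x * indicator {..t} x \<partial>?D) = F t * (1 + ?T t)"
    using integral_E[of "indicator {..t}"] cdf_E[of t] by (simp add: cdf_def)
  have x1: "(\<integral>x. x * indicator {..t} x \<partial>?D) = t * F t - I"
    using D.integral_atMost_id[of t] t by (simp add: F I_def)
  have "set_integrable lborel {0..t} F" "set_integrable lborel {0..t} (\<lambda>x. F x * ?T x)"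
    using D.set_integrable_cdf D.set_integrable_cdf_neg_log by (simp_all add: F)
  then have "(LBINT x:{0..t}. cdf ?E x) = I + J"
    by (simp add: cdf_E distrib_left I_def J_def set_integral_add)
  then have xT1: "(\<integral>x. ?T x * (x * indicator {..t} x) \<partial>?D) = t * (F t * (1 + ?T t)) - (I + J)"
    using E.integral_atMost_id[of t] integral_E[of "\<lambda>x. x * indicator {..t} x"] t
    by (simp add: cdf_E)
  \<comment> \<open>T is unbounded near 0, so the products with T are not covered by a bound under
    the law of \<open>X\<close>. Under the law of \<open>Y\<close> the same functions appear without
    T and are bounded on the relevant range.\<close>
  have integrable:
    "integrable ?D (\<lambda>x. ?T x * (x * indicator {..t} x))"
    "integrable ?D (\<lambda>x. ?T x * indicator {..t} x)"
    "integrable ?D (\<lambda>x. x * indicator {..t} x)"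
    "integrable ?D (\<lambda>x. indicator {..t} x :: real)"
    using integrable_E[of "\<lambda>x. x * indicator {..t} x"] integrable_E[of "indicator {..t}"]
      E.integrable_bounded_on_atMost[of "\<lambda>x. x" t t] E.integrable_bounded_on_atMost[of "\<lambda>_. 1" t 1]
      D.integrable_bounded_on_atMost[of "\<lambda>x. x" t t] D.integrable_bounded_on_atMost[of "\<lambda>_. 1" t 1]
    by simp_all
  have "(\<integral>x. (x - m) * (?T x - 1) * indicator {..t} x \<partial>?D)
      = (\<integral>x. ?T x * (x * indicator {..t} x) - x * indicator {..t} x
          - m * (?T x * indicator {..t} x) + m * indicator {..t} x \<partial>?D)"
    by (intro Bochner_Integration.integral_cong) (auto simp: algebra_simps)
  also have "\<dots> = (\<integral>x. ?T x * (x * indicator {..t} x) \<partial>?D) - (\<integral>x. x * indicator {..t} x \<partial>?D)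
      - m * (\<integral>x. ?T x * indicator {..t} x \<partial>?D) + m * (\<integral>x. indicator {..t} x \<partial>?D)"
    using integrable by simp
  also have "\<dots> = t * (F t * (1 + ?T t)) - (I + J) - (t * F t - I)
      - m * (F t * (1 + ?T t)) + m * F t"
    by (simp add: xT1 x1 T1) (simp add: F cdf_def)
  finally have cov: "(\<integral>x. (x - m) * (?T x - 1) * indicator {..t} x \<partial>?D) = \<dots>" .
  have "cond_cov N X (\<lambda>\<omega>. ?T (X \<omega>)) (at_most N X t)
      = (\<integral>x. (x - m) * (?T x - 1) * indicator {..t} x \<partial>?D) / F t"
    unfolding cond_cov_def mean_T m_def[symmetric]
    using cond_expect_at_most[OF N X, of "\<lambda>x. (x - m) * (?T x - 1)" t] Ft
    by (simp add: F)
  moreover have "mean_past_lifetime N X t = (t * F t - I) / F t"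
    using cond_expect_at_most[OF N X, of "\<lambda>x. x" t] Ft x1
    by (simp add: mean_past_lifetime_def F)
  moreover have "dyn_cumulative_entropy F t = (J - ?T t * I) / F t"
    using D.dyn_cumulative_entropy_eq[OF t] by (simp add: F I_def J_def)
  \<comment> \<open>The terms in \<open>I\<close> cancel on the right: the mean past lifetime
    contributes - T(t) I / F(t), and the subtracted entropy contributes + T(t) I / F(t).\<close>
  ultimately show ?thesis
    unfolding m_def[symmetric] cov using Ft by (simp only:) (simp add: field_simps)
qed

text \<open>Both sides equal the integral of F T over \<open>{0..t}\<close> divided by F(t): the
  entropy is this quotient minus T(t) times the mean inactivity time.\<close>

lemma cond_expect_neg_log_div_hazard:
  assumes N: "prob_space N" and X [measurable]: "X \<in> borel_measurable N"
    and pos: "positive_distribution (distr N borel X)"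
    and F: "F = cdf (distr N borel X)"
    and dens: "distr N borel X = density lborel (\<lambda>x. ennreal (f x))"
    and [measurable]: "f \<in> borel_measurable borel" and nonneg: "\<And>x. 0 \<le> f x"
    and ne: "AE x in lborel. 0 < x \<and> x \<le> t \<and> neg_log_cdf F x \<noteq> 0 \<longrightarrow> reversed_hazard f F x \<noteq> 0"
    and t: "0 < t"
  shows "cond_expect N (\<lambda>\<omega>. neg_log_cdf F (X \<omega>) / reversed_hazard f F (X \<omega>)) (at_most N X t)
    = dyn_cumulative_entropy F t + mean_inactivity_time N X t * neg_log_cdf F t"
proof -
  let ?T = "neg_log_cdf F"
  interpret D: positive_distribution "distr N borel X" by (rule pos)
  have [measurable]: "?T \<in> borel_measurable borel" "F \<in> borel_measurable borel"
    by (simp_all add: F)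
  have [measurable]: "reversed_hazard f F \<in> borel_measurable borel"
    unfolding reversed_hazard_def by measurable
  have Ft: "0 < F t" using D.cdf_pos[OF t] by (simp add: F)
  have "cond_expect N (\<lambda>\<omega>. ?T (X \<omega>) / reversed_hazard f F (X \<omega>)) (at_most N X t)
      = (LBINT x:{0..t}. F x * ?T x) / F t"
    using cond_expect_at_most[OF N X, of "\<lambda>x. ?T x / reversed_hazard f F x" t, folded F] Ft
      D.integral_neg_log_div_hazard[OF dens, of t, folded F] nonneg ne
    by simp
  moreover have "mean_inactivity_time N X t = (LBINT x:{0..t}. F x) / F t"
    using cond_expect_at_most[OF N X, of "\<lambda>x. t - x" t] Ft D.integral_inactivity[of t] t
    by (simp add: mean_inactivity_time_def F)
  moreover have "dyn_cumulative_entropy F t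
      = ((LBINT x:{0..t}. F x * ?T x) - ?T t * (LBINT x:{0..t}. F x)) / F t"
    using D.dyn_cumulative_entropy_eq[OF t] by (simp add: F)
  ultimately show ?thesis
    by (simp add: diff_divide_distrib)
qed

text \<open>This starts the induction. A Lebesgue density excludes atoms, and the missing atom at 0
  sharpens almost sure nonnegativity to \<open>cdf (distr M borel X) 0 = 0\<close>.\<close>

lemma positive_distributionI_density:
  assumes M: "prob_space M" and X: "distributed M lborel X f"
    and nonneg: "AE \<omega> in M. 0 \<le> X \<omega>"
    and pos: "\<And>x. 0 < x \<Longrightarrow> 0 < cdf (distr M borel X) x"
  shows "positive_distribution (distr M borel X)"
proof -
  interpret prob_space M by (rule M)
  have meas [measurable]: "X \<in> borel_measurable M"
    using distributed_measurable[OF X] by simp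
  interpret D: real_distribution "distr M borel X"
    by (rule real_distribution_distr) simp
  have dens: "distr M borel X = density lborel f"
    using distributed_distr_eq_density[OF X] by (simp cong: distr_cong)
  have atom: "measure (distr M borel X) {x} = 0" for x
  proof -
    have "{x} \<in> null_sets (density lborel f)"
      using absolutely_continuousI_density[OF distributed_borel_measurable[OF X]]
      by (auto simp: absolutely_continuous_def dest!: subsetD[where c = "{x}"])
    then show ?thesis
      by (simp add: dens null_sets_def measure_def)
  qed
  show ?thesis
  proof
    have "AE x in distr M borel X. 0 \<le> x"
      using nonneg by (subst AE_distr_iff) auto
    moreover have "AE x in distr M borel X. x \<noteq> 0"
      by (rule AE_I'[of "{0}"]) (auto simp: null_sets_def D.emeasure_eq_measure atom)
    ultimately have "AE x in distr M borel X. x \<notin> {..0}"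
      by eventually_elim auto
    then show "cdf (distr M borel X) 0 = 0"
      unfolding cdf_def using D.prob_eq_0[of "{..0}"] by simp
  qed (use atom pos in auto)
qed

section \<open>The whole sequence\<close>

text \<open>The guard on the first identity concerns division by zero: where the reversed hazard
  rate vanishes, the quotient is read as 0 in the code. The covariance identity contains no quotient
  by it.\<close>

theorem theorem7:
  fixes M :: "'a measure" and X :: "'a \<Rightarrow> real" and f F :: "real \<Rightarrow> real"
    and N :: "'b measure" and Xs :: "nat \<Rightarrow> 'b \<Rightarrow> real"
    and fs Fs T \<tau> :: "nat \<Rightarrow> real \<Rightarrow> real" and n :: nat and t :: real
  assumes M: "prob_space M"
    and X_nonneg: "AE \<omega> in M. 0 \<le> X \<omega>"
    and f_nonneg: "\<forall>x. 0 \<le> f x"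
    and X_pdf: "distributed M lborel X (\<lambda>x. ennreal (f x))"
    and X_cdf: "F = cdf (distr M borel X)"
    and F_pos: "\<forall>x>0. 0 < F x"
    and N: "prob_space N"
    and Xs_rv: "\<forall>k\<ge>1. Xs k \<in> borel_measurable N"
    and Xs_1: "distr N borel (Xs 1) = distr M borel X"
    and Xs_Suc: "\<forall>k\<ge>1. has_cond_law_pos N (Xs (k + 1)) (Xs k) (law_at_most N (Xs k))"
    and T: "\<forall>k\<ge>1. T k = neg_log_cdf (Fs k)"
    and \<tau>: "\<forall>k\<ge>1. \<tau> k = reversed_hazard (fs k) (Fs k)"
    and Fs_1: "Fs 1 = F"
    and Fs_Suc: "\<forall>k\<ge>1. \<forall>x. Fs (k + 1) x = Fs k x * (1 + T k x)"
    and fs_1: "fs 1 = f"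
    and fs_Suc: "\<forall>k\<ge>1. \<forall>x. fs (k + 1) x = T k x * fs k x"
    and n: "n \<ge> 1"
    and t: "t > 0"
  shows "((AE x in lborel. 0 < x \<and> x \<le> t \<and> T n x \<noteq> 0 \<longrightarrow> \<tau> n x \<noteq> 0) \<longrightarrow>
          cond_expect N (\<lambda>\<omega>. T n (Xs n \<omega>) / \<tau> n (Xs n \<omega>)) (at_most N (Xs n) t)
            = dyn_cumulative_entropy (Fs n) t + mean_inactivity_time N (Xs n) t * T n t)
       \<and> cond_cov N (Xs n) (\<lambda>\<omega>. T n (Xs n \<omega>)) (at_most N (Xs n) t)
            = T n t * (mean_past_lifetime N (Xs n) t - integral\<^sup>L N (Xs n))
              - dyn_cumulative_entropy (Fs n) t"
proof -
  let ?D = "\<lambda>k. distr N borel (Xs k)"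
  \<comment> \<open>The families \<open>Fs\<close> and \<open>fs\<close> are given by recursion
    alone; this induction identifies them with the CDFs and densities of the actual laws. Positivity
    of the law is carried along because each step of the construction relies on it.\<close>
  have laws: "positive_distribution (?D k) \<and> Fs k = cdf (?D k) \<and> (\<forall>x. 0 \<le> fs k x)
      \<and> fs k \<in> borel_measurable borel \<and> ?D k = density lborel (\<lambda>x. ennreal (fs k x))"
    if "1 \<le> k" for k
    using that
  proof (induction k rule: dec_induct)
    case base
    have "positive_distribution (distr M borel X)"
      using positive_distributionI_density[OF M X_pdf X_nonneg] F_pos X_cdf by simp
    moreover have "distr M borel X = density lborel (\<lambda>x. ennreal (f x))"
      using distributed_distr_eq_density[OF X_pdf] by (simp cong: distr_cong)
    moreover have "f \<in> borel_measurable borel"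
      using distributed_real_measurable[OF _ X_pdf] f_nonneg by simp
    ultimately show ?case
      using Fs_1 fs_1 Xs_1 X_cdf f_nonneg by simp
  next
    case (step k)
    then have pos: "positive_distribution (?D k)" and F: "Fs k = cdf (?D k)"
      and nonneg: "\<And>x. 0 \<le> fs k x" and [measurable]: "fs k \<in> borel_measurable borel"
      and dens: "?D k = density lborel (\<lambda>x. ennreal (fs k x))"
      by auto
    interpret D: positive_distribution "?D k" by (rule pos)
    have X: "Xs k \<in> borel_measurable N" and Y: "Xs (Suc k) \<in> borel_measurable N"
      and law: "has_cond_law_pos N (Xs (Suc k)) (Xs k) (law_at_most N (Xs k))"
      using Xs_rv Xs_Suc step.hyps by auto
    have Tk: "T k = neg_log_cdf (cdf (?D k))"
      using T F step.hyps by simp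
    have fS: "fs (Suc k) = (\<lambda>x. T k x * fs k x)"
      using fs_Suc step.hyps by auto
    have [measurable]: "T k \<in> borel_measurable borel"
      by (simp add: Tk)
    have "Fs (Suc k) = cdf (?D (Suc k))"
      using Fs_Suc step.hyps next_law_cdf[OF N X Y pos law] by (auto simp: F Tk)
    \<comment> \<open>A density relative to a law with Lebesgue density multiplies with it, which is
      the recursion for \<open>fs\<close>.\<close>
    moreover have "?D (Suc k) = density (density lborel (\<lambda>x. ennreal (fs k x))) (\<lambda>x. ennreal (T k x))"
      using next_law_density[OF N X Y pos law] by (simp only: Tk dens)
    then have "?D (Suc k) = density lborel (\<lambda>x. ennreal (fs (Suc k) x))"
      by (simp add: density_density_eq fS ennreal_mult''[symmetric] nonneg mult.commute)
    ultimately show ?case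
      using next_law_positive[OF N X Y pos law] nonneg D.neg_log_cdf_nonneg
      by (simp add: fS Tk)
  qed
  have X: "Xs n \<in> borel_measurable N" and Y: "Xs (n + 1) \<in> borel_measurable N"
    and law: "has_cond_law_pos N (Xs (n + 1)) (Xs n) (law_at_most N (Xs n))"
    and Tn: "T n = neg_log_cdf (Fs n)" and \<tau>n: "\<tau> n = reversed_hazard (fs n) (Fs n)"
    using Xs_rv Xs_Suc T \<tau> n by auto
  note L = laws[OF n]
  show ?thesis
    unfolding Tn \<tau>n
    using cond_expect_neg_log_div_hazard[OF N X, of "Fs n" "fs n" t]
      cond_cov_next_law[OF N X Y _ law, of "Fs n" t] L t
    by blast
qed

end
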